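(* Let $p_k$ denote the $k$th prime and, for $n\in\mathbb{Z}^+$ and $\alpha>0$, let $S_n^{(\alpha)}=\sum_{k=1}^n p_k^{\alpha}$. Let $\alpha\geqslant 1$ and define $$N(\alpha)=\max\left\{350000,\ \left\lceil e^{\left((\alpha+1)^2 1.2^{2\alpha+1}+(\alpha+1)1.2^{\alpha+1}\right)/\alpha}\right\rceil\right\}.$$ Then the sequence $$\left(\frac{\sqrt[n+1]{S^{(\alpha)}_{n+1}/(n+1)}}{\sqrt[n]{S^{(\alpha)}_n/n}}\right)_{n\geqslant N(\alpha)}$$ is strictly increasing.
   Context: $p_k$ is the $k$th prime ($p_1=2$), and $S_n^{(\alpha)}=\sum_{k=1}^n p_k^{\alpha}$. *)

theory Defs
  imports "HOL-Analysis.Analysis" "HOL-Computational_Algebra.Primes" "HOL-Library.Infinite_Set"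
begin

text \<open>The k-th prime, 1-indexed: nth_prime 1 = 2.\<close>
definition nth_prime :: "nat \<Rightarrow> nat" where
  "nth_prime k = enumerate {p::nat. prime p} (k - 1)"

definition S :: "real \<Rightarrow> nat \<Rightarrow> real" where
  "S \<alpha> n = (\<Sum>k=1..n. real (nth_prime k) powr \<alpha>)"

definition N :: "real \<Rightarrow> nat" where
  "N \<alpha> = max 350000
     (nat \<lceil>exp (((\<alpha> + 1)^2 * 1.2 powr (2*\<alpha> + 1) + (\<alpha> + 1) * 1.2 powr (\<alpha> + 1)) / \<alpha>)\<rceil>)"

definition ratio :: "real \<Rightarrow> nat \<Rightarrow> real" where
  "ratio \<alpha> n = root (n+1) (S \<alpha> (n+1) / real (n+1)) / root n (S \<alpha> n / real n)"

end

theory Submission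
  imports Defs "HOL-Number_Theory.Prime_Powers"
begin

text \<open>
  Write \<open>l n = ln (S \<alpha> n / n)\<close>, \<open>P\<close> for the prime number \<open>n + 1\<close>, \<open>q = P powr \<alpha> / S \<alpha> n\<close> and
  \<open>Q = n * q\<close>. The claim is that \<open>l n / n\<close> has a positive second difference. Clearing denominators
  and using that consecutive primes increase, it follows from \<open>2 * Q + Q\<^sup>2 < 2 * l n\<close>.
  Since \<open>l n = \<alpha> * ln P - ln Q\<close>, the definition of \<open>N \<alpha>\<close> makes this true as soon as
  \<open>Q \<le> 3 / 2 * X\<close> for \<open>X = (\<alpha> + 1) * 1.2 powr \<alpha>\<close>.

  To bound \<open>Q\<close>, only Chebyshev's estimates are needed: his combination
  \<open>ln [n]! - ln [n/2]! - ln [n/3]! - ln [n/5]! + ln [n/30]!\<close> shows that \<open>\<theta> x\<close> lies, up to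
  \<open>O(sqrt x * ln x)\<close>, between \<open>A * x\<close> and \<open>6 / 5 * A * x\<close>; the ratio \<open>6 / 5\<close> is the \<open>1.2\<close> of the
  theorem. The upper bound gives \<open>n * ln P \<le> 1.145 * (6 / 5 * A * P)\<close>. For the lower bound on
  \<open>S \<alpha> n\<close>, the worst case compatible with both estimates is that the primes below \<open>P\<close> fill
  \<open>[0, t]\<close> with logarithmic density \<open>6 / 5 * A\<close>, where \<open>t\<close> is about \<open>P / 1.2\<close>.
\<close>

section \<open>Chebyshev's estimates\<close>

lemma ln_ge_one_minus_inverse:
  fixes x :: real
  assumes "x > 0"
  shows "1 - 1 / x \<le> ln x"
  using ln_le_minus_one[of "1 / x"] assms by (simp add: ln_div)

text \<open>Induction: with the increment \<open>d = ln (n + 1) - ln n\<close>, the two induction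
  steps amount to \<open>n * d <= 1\<close> and \<open>1 <= (n + 1) * d\<close>.\<close>

lemma ln_fact_bounds:
  assumes "n \<ge> 1"
  shows "real n * ln n - n + 1 \<le> ln (fact n)"
    and "ln (fact n) \<le> real n * ln n - n + 1 + ln n"
proof -
  have "real n * ln n - n + 1 \<le> ln (fact n) \<and> ln (fact n) \<le> real n * ln n - n + 1 + ln n"
    using assms
  proof (induction n rule: nat_induct_at_least)
    case base
    show ?case by simp
  next
    case (Suc n)
    define d where "d = ln (1 + real n) - ln n"
    have n: "real n > 0" using Suc by simp
    have d: "d = ln ((1 + real n) / n)" using n by (simp add: d_def ln_div)
    have "d \<le> (1 + real n) / n - 1" unfolding d using n by (intro ln_le_minus_one) simp
    then have "real n * d \<le> real n * ((1 + real n) / n - 1)" using n by (intro mult_left_mono) auto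
    then have d1: "real n * d \<le> 1" using n by (simp add: field_simps)
    have "1 - 1 / ((1 + real n) / n) \<le> d" unfolding d
      using n by (intro ln_ge_one_minus_inverse) simp
    then have "(1 + real n) * (1 - 1 / ((1 + real n) / n)) \<le> (1 + real n) * d"
      using n by (intro mult_left_mono) auto
    then have d2: "1 \<le> (1 + real n) * d" using n by (simp add: field_simps)
    have f: "ln (fact (Suc n)) = ln (1 + real n) + ln (fact n)"
      by (simp add: ln_mult add_pos_pos)
    have l: "ln (1 + real n) = ln n + d" by (simp add: d_def)
    have s: "real (Suc n) = 1 + real n" by simp
    show ?case using Suc d1 d2 unfolding f s l by (simp add: algebra_simps)
  qed
  then show "real n * ln n - n + 1 \<le> ln (fact n)"
    and "ln (fact n) \<le> real n * ln n - n + 1 + ln n" by auto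
qed

lemma xlnx_minus_mono:
  fixes a b :: real
  assumes "1 \<le> a" "a \<le> b"
  shows "a * ln a - a \<le> b * ln b - b"
proof -
  have "1 - 1 / (b / a) \<le> ln (b / a)" using assms by (intro ln_ge_one_minus_inverse) simp
  then have "b * (1 - 1 / (b / a)) \<le> b * ln (b / a)" using assms by (intro mult_left_mono) auto
  also have "b * ln (b / a) = b * ln b - b * ln a" using assms by (simp add: ln_div right_diff_distrib)
  also have "b * (1 - 1 / (b / a)) = b - a" using assms by (simp add: right_diff_distrib)
  finally have "b - a \<le> b * ln b - b * ln a" .
  moreover have "a * ln a \<le> b * ln a" using assms by (intro mult_right_mono) auto
  ultimately show ?thesis by linarith
qed

text \<open>A bound in the real variable \<open>y\<close>, later \<open>x / k\<close>, instead of
  its floor lets the main terms of five factorials cancel exactly. The error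
  \<open>ln (1 + y)\<close>, unlike \<open>ln y\<close>, is nonnegative and so also covers
  \<open>m = 0\<close>.\<close>

lemma ln_fact_floor_le:
  fixes y :: real
  assumes "y > 0" "real m \<le> y"
  shows "ln (fact m) \<le> y * ln y - y + 1 + ln (1 + y)"
proof (cases "m = 0")
  case True
  have "y * (1 - 1 / y) \<le> y * ln y"
    using ln_ge_one_minus_inverse[of y] assms by (intro mult_left_mono) auto
  also have "y * (1 - 1 / y) = y - 1" using assms by (simp add: right_diff_distrib)
  finally have "y - 1 \<le> y * ln y" .
  then show ?thesis using True assms by (simp add: add_increasing2)
next
  case False
  have "ln (fact m) \<le> real m * ln m - m + 1 + ln m" using False by (intro ln_fact_bounds) simp
  also have "\<dots> \<le> y * ln y - y + 1 + ln (1 + y)"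
  proof -
    have "real m * ln m - m \<le> y * ln y - y" using False assms by (intro xlnx_minus_mono) auto
    moreover have "ln (real m) \<le> ln (1 + y)" using False assms by (intro ln_mono) auto
    ultimately show ?thesis by linarith
  qed
  finally show ?thesis .
qed

lemma ln_fact_floor_ge:
  fixes y :: real
  assumes "y \<ge> 1" "y < real m + 1" "real m \<le> y"
  shows "y * ln y - y + 1 - ln (1 + y) \<le> ln (fact m)"
proof -
  \<comment> \<open>The bound is taken at \<open>m + 1\<close>, which exceeds \<open>y\<close>;
    removing the factor \<open>m + 1\<close> from the factorial costs only
    \<open>ln (m + 1) <= ln (1 + y)\<close>.\<close>
  have "real (Suc m) * ln (Suc m) - Suc m + 1 \<le> ln (fact (Suc m))" by (intro ln_fact_bounds) simp
  also have "ln (fact (Suc m)) = ln (Suc m) + ln (fact m :: real)"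
    by (simp add: ln_mult add_pos_pos del: of_nat_Suc)
  finally have "real (Suc m) * ln (Suc m) - Suc m + 1 - ln (Suc m) \<le> ln (fact m)" by simp
  moreover have "y * ln y - y \<le> real (Suc m) * ln (Suc m) - Suc m"
    using assms by (intro xlnx_minus_mono) auto
  moreover have "ln (real (Suc m)) \<le> ln (1 + y)" using assms by (intro ln_mono) auto
  ultimately show ?thesis by linarith
qed

text \<open>Chebyshev's constant \<open>ln (2^(1/2) * 3^(1/3) * 5^(1/5) / 30^(1/30))\<close>, about
  0.9213.\<close>

definition cheb_const :: real
  where "cheb_const = 7 / 15 * ln 2 + 3 / 10 * ln 3 + 1 / 6 * ln 5"

lemma cheb_const_bounds: "83 / 100 \<le> cheb_const" "cheb_const \<le> 1"
proof -
  have l4: "ln (4::real) = 2 * ln 2" using ln_realpow[of 2 2] by simp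
  have "(1::real) \<le> ln 3" using ln_272_gt_1 ln_mono[of "272/100" "3::real"] by linarith
  moreover have "ln (4::real) \<le> ln 5" by simp
  ultimately show "83 / 100 \<le> cheb_const"
    using ln2_ge_two_thirds l4 unfolding cheb_const_def by linarith
  have "ln (3 / 2 :: real) \<le> 1 / 2" "ln (5 / 4 :: real) \<le> 1 / 4"
    using ln_le_minus_one[of "3/2"] ln_le_minus_one[of "5/4"] by auto
  then have "ln 3 \<le> ln 2 + (1/2::real)" "ln 5 \<le> ln 4 + (1/4::real)"
    by (simp_all add: ln_div)
  then show "cheb_const \<le> 1" using ln2_le_25_over_36 l4 unfolding cheb_const_def by linarith
qed

section \<open>Von Mangoldt sums and Chebyshev's factorial combination\<close>

definition psi :: "nat \<Rightarrow> real" where "psi n = (\<Sum>d = 1..n. mangoldt d)"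

definition theta :: "nat \<Rightarrow> real" where "theta n = (\<Sum>p | prime p \<and> p \<le> n. ln (real p))"

text \<open>Write each \<open>ln k\<close> as the sum of \<open>mangoldt d\<close> over the divisors
  of \<open>k\<close> and exchange sums: \<open>d\<close> is counted once per multiple up to
  \<open>m\<close>. Since \<open>m div d = 0\<close> for \<open>d > m\<close>, a common limit
  \<open>n\<close> is possible, so that factorials of different arguments combine termwise.\<close>

lemma ln_fact_eq_sum_mangoldt:
  assumes "m \<le> n"
  shows "ln (fact m) = (\<Sum>d = 1..n. mangoldt d * real (m div d))"
proof -
  have "ln (fact m) = (\<Sum>k = 1..m. ln (real k))"
    by (induction m) (simp_all add: ln_mult add_pos_pos del: of_nat_Suc)
  also have "\<dots> = (\<Sum>k = 1..m. \<Sum>d | d dvd k. mangoldt d)"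
    by (intro sum.cong) (use mangoldt_sum[where ?'a = real] in auto)
  also have "\<dots> = (\<Sum>k = 1..m. \<Sum>d \<in> {d \<in> {1..n}. d dvd k}. mangoldt d)"
  proof (intro sum.cong refl)
    fix k d assume "k \<in> {1..m}"
    then have "d dvd k \<Longrightarrow> d \<le> k \<and> d \<noteq> 0" for d by (auto dest: dvd_imp_le)
    then show "{d. d dvd k} = {d \<in> {1..n}. d dvd k}"
      using \<open>k \<in> {1..m}\<close> assms by (force simp: Suc_le_eq)
  qed
  also have "\<dots> = (\<Sum>d = 1..n. \<Sum>k \<in> {k \<in> {1..m}. d dvd k}. mangoldt d)"
    by (rule sum.swap_restrict) auto
  also have "\<dots> = (\<Sum>d = 1..n. mangoldt d * real (m div d))"
  proof (intro sum.cong refl)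
    fix d assume d: "d \<in> {1..n}"
    have "{k \<in> {1..m}. d dvd k} = (\<lambda>j. d * j) ` {1..m div d}"
      using d by (auto simp: less_eq_div_iff_mult_less_eq mult.commute elim!: dvdE)
    moreover have "inj_on (\<lambda>j. d * j) {1..m div d}" using d by (auto simp: inj_on_def)
    ultimately have "card {k \<in> {1..m}. d dvd k} = m div d" by (simp add: card_image)
    then show "(\<Sum>k \<in> {k \<in> {1..m}. d dvd k}. mangoldt d) = mangoldt d * real (m div d)" by simp
  qed
  finally show ?thesis .
qed

text \<open>As \<open>1 + 1/30 = 1/2 + 1/3 + 1/5\<close>, the difference of the two sides depends
  only on \<open>m mod 30\<close>, so thirty residues suffice. With \<open>m = n div d\<close> it is
  the coefficient of \<open>mangoldt d\<close> in \<open>chebU n\<close>.\<close>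

lemma chebyshev_div_bounds:
  fixes m :: nat
  shows "m div 2 + m div 3 + m div 5 \<le> m + m div 30"
    and "m + m div 30 \<le> m div 2 + m div 3 + m div 5 + 1"
    and "1 \<le> m \<Longrightarrow> m \<le> 5 \<Longrightarrow> m + m div 30 = m div 2 + m div 3 + m div 5 + 1"
proof -
  define q r where "q = m div 30" and "r = m mod 30"
  have m: "m = 30 * q + r" and r: "r < 30" by (simp_all add: q_def r_def)
  have *: "m div 30 = q + r div 30" "m div 2 = 15 * q + r div 2" "m div 3 = 10 * q + r div 3"
    "m div 5 = 6 * q + r div 5" unfolding m by presburger+
  have "r \<in> set [0..<30]" using r by auto
  moreover have "\<forall>r \<in> set [0..<30]. r div 2 + r div 3 + r div 5 \<le> r + r div 30 \<and>
      r + r div 30 \<le> r div 2 + r div 3 + r div 5 + 1"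
    by code_simp
  ultimately have "r div 2 + r div 3 + r div 5 \<le> r + r div 30 \<and> r + r div 30 \<le> r div 2 + r div 3 + r div 5 + 1"
    by blast
  with * show "m div 2 + m div 3 + m div 5 \<le> m + m div 30"
    and "m + m div 30 \<le> m div 2 + m div 3 + m div 5 + 1" using m by linarith+
  assume "1 \<le> m" "m \<le> 5"
  then have "m = 1 \<or> m = 2 \<or> m = 3 \<or> m = 4 \<or> m = 5" by linarith
  then show "m + m div 30 = m div 2 + m div 3 + m div 5 + 1" by auto
qed

definition chebU :: "nat \<Rightarrow> real" where
  "chebU n = ln (fact n) - ln (fact (n div 2)) - ln (fact (n div 3)) - ln (fact (n div 5))
     + ln (fact (n div 30))"

lemma chebU_altdef:
  "chebU n = (\<Sum>d = 1..n. mangoldt d * (real (n div d) - real (n div d div 2) - real (n div d div 3)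
      - real (n div d div 5) + real (n div d div 30)))"
proof -
  have *: "ln (fact (n div k)) = (\<Sum>d = 1..n. mangoldt d * real (n div d div k))" for k
    by (subst ln_fact_eq_sum_mangoldt[of "n div k" n]) (simp_all add: div_mult2_eq[symmetric] mult.commute)
  show ?thesis
    unfolding chebU_def * ln_fact_eq_sum_mangoldt[OF order_refl, of n]
    by (simp add: sum.distrib[symmetric] sum_subtractf[symmetric] algebra_simps)
qed

lemma chebU_le_psi: "chebU n \<le> psi n"
  unfolding chebU_altdef psi_def
proof (intro sum_mono)
  fix d
  have "real (n div d + n div d div 30) \<le> real (n div d div 2 + n div d div 3 + n div d div 5 + 1)"
    using chebyshev_div_bounds(2) of_nat_le_iff by blast
  then show "mangoldt d * (real (n div d) - real (n div d div 2) - real (n div d div 3)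
      - real (n div d div 5) + real (n div d div 30)) \<le> mangoldt d"
    by (intro mult_left_le mangoldt_nonneg) simp
qed

text \<open>All coefficients in \<open>chebU_altdef\<close> are nonnegative, and for
  \<open>n div 6 < d <= n\<close> they are 1, because then \<open>n div d\<close> lies between 1 and
  5. The other terms are dropped.\<close>

lemma psi_diff_le_chebU: "psi n - psi (n div 6) \<le> chebU n"
proof -
  let ?c = "\<lambda>d. real (n div d) - real (n div d div 2) - real (n div d div 3)
      - real (n div d div 5) + real (n div d div 30)"
  have c: "0 \<le> ?c d" for d
  proof -
    have "real (n div d div 2 + n div d div 3 + n div d div 5) \<le> real (n div d + n div d div 30)"
      using chebyshev_div_bounds(1) of_nat_le_iff by blast
    then show ?thesis by simp
  qed
  have "psi n = psi (n div 6) + (\<Sum>d = n div 6 + 1..n. mangoldt d)"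
    unfolding psi_def using sum.ub_add_nat[of 1 "n div 6" mangoldt "n - n div 6"] by simp
  then have "psi n - psi (n div 6) = (\<Sum>d = n div 6 + 1..n. mangoldt d)" by simp
  also have "\<dots> = (\<Sum>d = n div 6 + 1..n. mangoldt d * ?c d)"
  proof (intro sum.cong refl)
    fix d assume d: "d \<in> {n div 6 + 1..n}"
    have "1 \<le> n div d" using d by (simp add: less_eq_div_iff_mult_less_eq)
    moreover have "n div d < 6" using d by (intro less_mult_imp_div_less) auto
    ultimately have "real (n div d + n div d div 30) = real (n div d div 2 + n div d div 3 + n div d div 5 + 1)"
      by (subst chebyshev_div_bounds(3)) auto
    then show "mangoldt d = mangoldt d * ?c d" by simp
  qed
  also have "\<dots> \<le> chebU n" unfolding chebU_altdef
    by (intro sum_mono2) (auto intro!: mult_nonneg_nonneg mangoldt_nonneg c)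
  finally show ?thesis .
qed

lemma chebU_bounds:
  assumes "n \<ge> 5"
  shows "chebU n \<le> cheb_const * n + 3 + 5 * ln n"
    and "n \<ge> 30 \<Longrightarrow> cheb_const * n - 3 - 5 * ln n \<le> chebU n"
proof -
  define x where "x = real n"
  have x: "x \<ge> 1" using assms by (simp add: x_def)
  define G where "G = (\<lambda>y::real. y * ln y - y + 1)"
  have fl: "real (n div k) \<le> x / k" "x / k < real (n div k) + 1" if "k > 0" for k :: nat
  proof -
    have "real (n div k * k) \<le> real n" by (intro of_nat_mono) simp
    then show "real (n div k) \<le> x / k" using that by (simp add: x_def field_simps)
    have "n < (n div k + 1) * k" using that
      by (metis Suc_eq_plus1 dividend_less_div_times mult_Suc add.commute)
    then have "real n < real ((n div k + 1) * k)" by (simp only: of_nat_less_iff)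
    then show "x / k < real (n div k) + 1" using that by (simp add: x_def field_simps)
  qed
  have up: "ln (fact (n div k)) \<le> G (x / k) + ln (1 + x / k)" if "k > 0" for k :: nat
    using ln_fact_floor_le[of "x / k" "n div k"] fl[OF that] x that by (simp add: G_def)
  have lo: "G (x / k) - ln (1 + x / k) \<le> ln (fact (n div k))" if "k > 0" "k \<le> n" for k :: nat
    using ln_fact_floor_ge[of "x / k" "n div k"] fl[of k] x that by (simp add: G_def x_def)
  have l30: "ln (30::real) = ln 2 + ln 3 + ln 5"
    using ln_mult[of "2::real" 3] ln_mult[of "6::real" 5] by simp
  \<comment> \<open>The linear terms and the \<open>x * ln x\<close> terms cancel by
    \<open>1 + 1/30 = 1/2 + 1/3 + 1/5\<close>; the constants of \<open>G\<close> add up to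
    -1.\<close>
  have main: "G x - G (x / 2) - G (x / 3) - G (x / 5) + G (x / 30) = cheb_const * x - 1"
    using x by (simp add: G_def cheb_const_def ln_div l30 field_simps)
  have err: "ln (1 + x) + ln (1 + x / 2) + ln (1 + x / 3) + ln (1 + x / 5) + ln (1 + x / 30) \<le> 5 * ln x + 2"
  proof -
    have *: "ln (1 + x / k) \<le> ln x + ln (1 + 1 / k)" if "k > 0" for k
    proof -
      have "ln (1 + x / k) \<le> ln (x * (1 + 1 / k))" using x that
        by (intro ln_mono) (auto simp: field_simps add_pos_pos)
      also have "\<dots> = ln x + ln (1 + 1 / k)" using x that by (intro ln_mult_pos) (auto simp: add_pos_pos)
      finally show ?thesis .
    qed
    \<comment> \<open>The product is 4.96, below \<open>5 = 2^2 * (5/4)\<close>, whose logarithm is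
      less than 2.\<close>
    have "ln ((2::real) * (3/2) * (4/3) * (6/5) * (31/30)) = ln 2 + ln (3/2) + ln (4/3) + ln (6/5) + ln (31/30)"
      by (simp only: ln_mult_pos mult_pos_pos zero_less_divide_iff zero_less_numeral simp_thms)
    moreover have "ln ((2::real) * (3/2) * (4/3) * (6/5) * (31/30)) \<le> ln (2 ^ 2 * (5 / 4))"
      by (intro ln_mono) auto
    moreover have "ln ((2::real) ^ 2 * (5 / 4)) = 2 * ln 2 + ln (5 / 4)"
      by (subst ln_mult_pos) (simp_all add: ln_realpow del: power_numeral)
    moreover have "ln (5 / 4 :: real) \<le> 1 / 4" using ln_le_minus_one[of "5/4"] by simp
    ultimately show ?thesis using *[of 1] *[of 2] *[of 3] *[of 5] *[of 30] ln2_le_25_over_36 by simp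
  qed
  show "chebU n \<le> cheb_const * n + 3 + 5 * ln n"
    using up[of 1] lo[of 2] lo[of 3] lo[of 5] up[of 30] main err assms
    unfolding chebU_def x_def by simp
  show "cheb_const * n - 3 - 5 * ln n \<le> chebU n" if "n \<ge> 30"
    using lo[of 1] up[of 2] up[of 3] up[of 5] lo[of 30] main err that
    unfolding chebU_def x_def by simp
qed

text \<open>Iterating \<open>psi n <= psi (n div 6) + chebU n\<close> produces the geometric series
  \<open>1 + 1/6 + 1/36 + ... = 6/5\<close>. The term \<open>9 * sqrt n\<close> absorbs the
  logarithmic errors: \<open>9/22\<close> is slightly above \<open>1 / sqrt 6\<close>, and
  \<open>9 * (9/22) + 5 <= 9\<close>.\<close>

lemma psi_le:
  "psi n \<le> 6 / 5 * cheb_const * n + 9 * sqrt n"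
proof (induction n rule: less_induct)
  case (less n)
  consider "n = 0" | "n \<ge> 1" "n < 5" | "n \<ge> 5" by linarith
  then show ?case
  proof cases
    case 1
    then show ?thesis by (simp add: psi_def)
  next
    case 2
    have "psi n \<le> (\<Sum>d = 1..n. mangoldt d * real (n div d))"
      unfolding psi_def
    proof (intro sum_mono)
      fix d assume "d \<in> {1..n}"
      then have "1 \<le> real (n div d)" by (simp add: Suc_le_eq div_greater_zero_iff)
      then show "mangoldt d \<le> mangoldt d * real (n div d)"
        using mangoldt_nonneg[of d] mult_left_mono[of 1 "real (n div d)" "mangoldt d :: real"] by simp
    qed
    also have "\<dots> = ln (fact n)" by (rule ln_fact_eq_sum_mangoldt[symmetric]) simp
    also have "\<dots> \<le> ln (fact 4)" using 2 by (intro ln_mono fact_mono) auto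
    also have "\<dots> \<le> ln (2 ^ 5)" by (intro ln_mono) (simp_all add: fact_numeral)
    also have "\<dots> \<le> 9" using ln2_le_25_over_36 by (simp add: ln_realpow del: power_numeral)
    also have "9 \<le> 9 * sqrt n" using 2 by simp
    also have "\<dots> \<le> 6 / 5 * cheb_const * n + 9 * sqrt n" using cheb_const_bounds by simp
    finally show ?thesis .
  next
    case 3
    define z where "z = sqrt n"
    have z: "z > 0" "z ^ 2 = n" using 3 by (simp_all add: z_def)
    have "real (6 * (n div 6)) \<le> real n" by (intro of_nat_mono) simp
    then have d6: "real (n div 6) \<le> n / 6" by simp
    have "psi n \<le> psi (n div 6) + cheb_const * n + (3 + 5 * ln n)"
      using psi_diff_le_chebU[of n] chebU_bounds(1)[of n] 3 by simp
    moreover have "psi (n div 6) \<le> 6 / 5 * cheb_const * (n div 6) + 9 * sqrt (n div 6)"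
      using 3 by (intro less) auto
    moreover have "6 / 5 * cheb_const * (n div 6) \<le> 6 / 5 * cheb_const * (n / 6)"
      using cheb_const_bounds by (intro mult_left_mono) (use d6 in auto)
    moreover have "sqrt (n div 6) \<le> 9 / 22 * z"
    proof -
      have "real (n div 6) \<le> n / 6" by (rule d6)
      also have "\<dots> \<le> (9 / 22 * z) ^ 2" using z by (simp add: power_mult_distrib power2_eq_square)
      finally show ?thesis using z by (intro real_le_lsqrt) auto
    qed
    moreover have "3 + 5 * ln n \<le> 5 * z"
    proof -
      have "ln n = 2 * ln z" using z ln_realpow[of z 2] by simp
      \<comment> \<open>The tangent to \<open>ln\<close> at 2 has slope 1/2, which matches
        \<open>10 * ln z\<close> with \<open>5 * z\<close>.\<close>
      moreover have "ln z - ln 2 \<le> z / 2 - 1" using ln_le_minus_one[of "z / 2"] z by (simp add: ln_div)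
      ultimately show ?thesis using ln2_le_25_over_36 by linarith
    qed
    ultimately show ?thesis using z(1) unfolding z_def by argo
  qed
qed

section \<open>Comparison of theta with psi\<close>

lemma theta_Suc: "theta (Suc n) = theta n + (if prime (Suc n) then ln (real (Suc n)) else 0)"
proof (cases "prime (Suc n)")
  case True
  have "{p. prime p \<and> p \<le> Suc n} = insert (Suc n) {p. prime p \<and> p \<le> n}"
    using True by (auto simp: le_Suc_eq)
  then show ?thesis using True by (simp add: theta_def)
next
  case False
  then have "{p. prime p \<and> p \<le> Suc n} = {p. prime p \<and> p \<le> n}" by (auto simp: le_Suc_eq)
  then show ?thesis using False by (simp add: theta_def)
qed

lemma theta_mono: "m \<le> n \<Longrightarrow> theta m \<le> theta n"
  unfolding theta_def by (intro sum_mono2) (auto dest: prime_ge_1_nat)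

lemma theta_le_psi: "theta n \<le> psi n"
proof -
  have "theta n = (\<Sum>p | prime p \<and> p \<le> n. mangoldt p)"
    unfolding theta_def by (intro sum.cong) auto
  also have "\<dots> \<le> psi n" unfolding psi_def
    by (intro sum_mono2 mangoldt_nonneg) (auto dest: prime_ge_1_nat)
  finally show ?thesis .
qed

text \<open>Only powers \<open>p ^ k\<close> with \<open>k >= 2\<close> separate \<open>psi\<close>
  from \<open>theta\<close>. Their bases are at most \<open>sqrt n\<close>, and a base
  \<open>p\<close> has at most \<open>ln n / ln p\<close> such exponents, each of weight
  \<open>ln p\<close>, so it contributes at most \<open>ln n\<close>.\<close>

lemma psi_le_theta_plus:
  assumes "n \<ge> 1"
  shows "psi n \<le> theta n + sqrt n * ln n"
proof -
  define P where "P = {p::nat. prime p \<and> p ^ 2 \<le> n}"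
  define K where "K = (\<lambda>p::nat. {k. 2 \<le> k \<and> p ^ k \<le> n})"
  have PsqI: "real p \<le> sqrt n" if "p \<in> P" for p
  proof -
    have "real (p ^ 2) \<le> real n" using that by (simp only: P_def of_nat_le_iff mem_Collect_eq)
    then show ?thesis by (intro real_le_rsqrt) simp
  qed
  have Psub: "P \<subseteq> {1..nat \<lfloor>sqrt n\<rfloor>}"
    using PsqI by (auto simp: P_def le_nat_floor Suc_le_eq prime_gt_0_nat)
  have finP: "finite P" using Psub finite_subset by blast
  have cardP: "real (card P) \<le> sqrt n"
  proof -
    have "card P \<le> nat \<lfloor>sqrt n\<rfloor>" using card_mono[OF _ Psub] by simp
    also have "real \<dots> \<le> sqrt n" by simp
    finally show ?thesis by simp
  qed
  have Klog: "real k * ln p \<le> ln n" if "prime p" "k \<in> K p" for p k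
  proof -
    have "real (p ^ k) \<le> real n" using that by (simp only: K_def of_nat_le_iff mem_Collect_eq)
    then have "ln (real p ^ k) \<le> ln n" using that prime_gt_0_nat by (intro ln_mono) auto
    then show ?thesis using that prime_gt_0_nat by (simp add: ln_realpow)
  qed
  have lnp: "ln (real p) > 0" if "prime p" for p using prime_gt_1_nat[OF that] by simp
  have Kle: "K p \<subseteq> {1..nat \<lfloor>ln n / ln p\<rfloor>}" if "prime p" for p
    using Klog[OF that] lnp[OF that] by (auto simp: K_def le_nat_floor field_simps)
  have finK: "finite (K p)" if "prime p" for p using Kle[OF that] finite_subset by blast
  have finPK: "finite (Sigma P K)" using finP by (rule finite_SigmaI) (simp add: P_def finK)
  have Ksum: "(\<Sum>k\<in>K p. ln (real p)) \<le> ln n" if "prime p" for p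
  proof -
    have "card (K p) \<le> nat \<lfloor>ln n / ln p\<rfloor>" using card_mono[OF _ Kle[OF that]] by simp
    also have "real \<dots> \<le> ln n / ln p" using lnp[OF that] assms by simp
    finally show ?thesis using lnp[OF that] by (simp add: field_simps)
  qed
  have "psi n = (\<Sum>d \<in> {d \<in> {1..n}. primepow d}. mangoldt d)"
    unfolding psi_def by (intro sum.mono_neutral_right) (auto simp: mangoldt_def)
  also have "\<dots> \<le> (\<Sum>d \<in> {p. prime p \<and> p \<le> n} \<union> (\<lambda>(p, k). p ^ k) ` Sigma P K. mangoldt d)"
  proof (intro sum_mono2 mangoldt_nonneg)
    show "finite ({p. prime p \<and> p \<le> n} \<union> (\<lambda>(p, k). p ^ k) ` Sigma P K)"
      using finP finK by (auto simp: P_def)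
    show "{d \<in> {1..n}. primepow d} \<subseteq> {p. prime p \<and> p \<le> n} \<union> (\<lambda>(p, k). p ^ k) ` Sigma P K"
    proof
      fix d assume "d \<in> {d \<in> {1..n}. primepow d}"
      then obtain p k where d: "prime p" "k > 0" "d = p ^ k" "p ^ k \<le> n"
        by (auto simp: primepow_def)
      show "d \<in> {p. prime p \<and> p \<le> n} \<union> (\<lambda>(p, k). p ^ k) ` Sigma P K"
      proof (cases "k = 1")
        case True
        then show ?thesis using d by auto
      next
        case False
        then have "k \<ge> 2" using d by simp
        then have "p ^ 2 \<le> n" using d(1,4) power_increasing[of 2 k p] prime_gt_0_nat[of p]
          by (metis One_nat_def Suc_leI le_trans)
        then have "(p, k) \<in> Sigma P K" using d \<open>k \<ge> 2\<close> by (auto simp: P_def K_def)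
        then show ?thesis using d(3) by force
      qed
    qed
  qed
  also have "\<dots> \<le> (\<Sum>d | prime d \<and> d \<le> n. mangoldt d) + (\<Sum>d \<in> (\<lambda>(p, k). p ^ k) ` Sigma P K. mangoldt d)"
    using finP finK by (subst sum_Un) (auto simp: P_def simp del: mangoldt_prime mangoldt_primepow' intro!: sum_nonneg mangoldt_nonneg)
  also have "(\<Sum>d | prime d \<and> d \<le> n. mangoldt d) = theta n"
    unfolding theta_def by (intro sum.cong) auto
  also have "(\<Sum>d \<in> (\<lambda>(p, k). p ^ k) ` Sigma P K. mangoldt d) \<le> (\<Sum>(p, k) \<in> Sigma P K. mangoldt (p ^ k) :: real)"
    using sum_image_le[of "Sigma P K" "mangoldt :: nat \<Rightarrow> real" "\<lambda>(p, k). p ^ k"] finPK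
    by (simp add: o_def case_prod_unfold mangoldt_nonneg)
  also have "\<dots> = (\<Sum>p\<in>P. \<Sum>k\<in>K p. mangoldt (p ^ k))"
    using finP finK by (subst sum.Sigma) (auto simp: P_def)
  also have "\<dots> = (\<Sum>p\<in>P. \<Sum>k\<in>K p. ln (real p))"
    by (intro sum.cong refl) (auto simp: P_def K_def)
  also have "\<dots> \<le> (\<Sum>p\<in>P. ln (real n))"
    using Ksum by (intro sum_mono) (auto simp: P_def)
  also have "\<dots> \<le> sqrt n * ln n" using cardP assms by (simp add: mult_right_mono)
  finally show ?thesis by simp
qed

lemma theta_le: "theta n \<le> 6 / 5 * cheb_const * n + 9 * sqrt n"
  using theta_le_psi psi_le order_trans by blast

lemma theta_ge:
  assumes "n \<ge> 30"
  shows "cheb_const * n - 3 - 5 * ln n - sqrt n * ln n \<le> theta n"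
  using chebU_bounds(2)[of n] chebU_le_psi[of n] psi_le_theta_plus[of n] assms by simp

section \<open>Upper bound for the number of primes\<close>

definition prime_count :: "nat \<Rightarrow> nat" where "prime_count n = card {p. prime p \<and> p \<le> n}"

text \<open>\<open>theta\<close> jumps by \<open>ln k\<close> exactly at the primes
  \<open>k\<close>; sums over primes thus become Stieltjes sums, ready for summation by
  parts.\<close>

lemma sum_primes_eq_sum_theta_diff:
  "(\<Sum>p | prime p \<and> p \<le> n. g p * ln (real p)) = (\<Sum>k = 1..n. g k * (theta k - theta (k - 1)))"
proof (induction n)
  case 0
  then show ?case by (auto intro!: sum.neutral)
next
  case (Suc n)
  show ?case
  proof (cases "prime (Suc n)")
    case True
    have "{p. prime p \<and> p \<le> Suc n} = insert (Suc n) {p. prime p \<and> p \<le> n}"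
      using True by (auto simp: le_Suc_eq)
    then show ?thesis using True Suc by (simp add: theta_Suc)
  next
    case False
    then have "{p. prime p \<and> p \<le> Suc n} = {p. prime p \<and> p \<le> n}" by (auto simp: le_Suc_eq)
    then show ?thesis using False Suc by (simp add: theta_Suc)
  qed
qed

lemma theta_1 [simp]: "theta (Suc 0) = 0" and theta_0 [simp]: "theta 0 = 0"
  by (auto simp: theta_def dest: prime_gt_1_nat intro!: sum.neutral)

text \<open>Summation by parts: \<open>H >= 0\<close> meets differences of \<open>f\<close> of one
  sign, so only boundary terms remain. The start at 2 suits the weight \<open>1 / ln k\<close>,
  whose value at 1 is 0 and would break monotonicity.\<close>

lemma sum_antimono_diff_ge:
  fixes f H :: "nat \<Rightarrow> real"
  assumes "m \<ge> 2" "\<And>k. 2 \<le> k \<Longrightarrow> f (Suc k) \<le> f k" "\<And>k. H k \<ge> 0"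
  shows "f m * H m - f 2 * H 1 \<le> (\<Sum>k = 2..m. f k * (H k - H (k - 1)))"
  using assms(1)
proof (induction m rule: nat_induct_at_least)
  case base
  then show ?case by (simp add: algebra_simps)
next
  case (Suc m)
  have "f (Suc m) * H m \<le> f m * H m" using Suc assms by (intro mult_right_mono) auto
  then show ?case using Suc by (simp add: algebra_simps)
qed

text \<open>The derivative of \<open>x / (ln x - 3/2)\<close> is at least \<open>1 / ln x\<close>
  once \<open>ln x >= 9/2\<close>, which holds from 100 on. The 150 pays for the 99 terms up to 100,
  each at most 3/2.\<close>

lemma sum_inverse_ln_le:
  assumes "m \<ge> 100"
  shows "(\<Sum>k = 2..m. 1 / ln (real k)) \<le> m / (ln m - 3 / 2) + 150"
  using assms
proof (induction m rule: nat_induct_at_least)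
  case base
  have "(\<Sum>k = 2..100. 1 / ln (real k)) \<le> (\<Sum>k = 2..100::nat. 3 / 2)"
  proof (intro sum_mono)
    fix k :: nat assume "k \<in> {2..100}"
    then have "ln 2 \<le> ln (real k)" by (intro ln_mono) auto
    then have "2 / 3 \<le> ln (real k)" using ln2_ge_two_thirds by linarith
    then show "1 / ln (real k) \<le> 3 / 2" by (simp add: field_simps)
  qed
  moreover have "3 / 2 \<le> ln (100::real)"
  proof -
    have "2 \<le> ln ((272/100::real) ^ 2)" using ln_272_gt_1 by (subst ln_realpow) auto
    also have "\<dots> \<le> ln 100" by (intro ln_mono) (simp_all add: power_divide)
    finally show ?thesis by simp
  qed
  ultimately show ?case by (simp add: add_increasing)
next
  case (Suc m)
  let ?g = "\<lambda>x::real. x / (ln x - 3 / 2)"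
  \<comment> \<open>\<open>2.72 ^ 9\<close> is about 8149, below \<open>100 ^ 2\<close>.\<close>
  have "9 \<le> ln ((272/100::real) ^ 9)" using ln_272_gt_1 by (subst ln_realpow) auto
  also have "\<dots> \<le> ln (100 ^ 2)" by (intro ln_mono) (simp_all add: power_divide)
  also have "\<dots> = 2 * ln 100" by (subst ln_realpow) auto
  finally have l100: "9 / 2 \<le> ln (100::real)" by simp
  have big: "9 / 2 \<le> ln x" if "x \<ge> real m" for x
  proof -
    have "100 \<le> x" using Suc that by linarith
    then have "ln 100 \<le> ln x" by (intro ln_mono) auto
    then show ?thesis using l100 by linarith
  qed
  have der: "(?g has_real_derivative (ln x - 5 / 2) / (ln x - 3 / 2) ^ 2) (at x)" if "x \<ge> real m" for x
  proof -
    have x: "x > 0" "ln x - 3 / 2 \<noteq> 0" using that Suc big[OF that] by auto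
    have "(?g has_real_derivative (1 * (ln x - 3 / 2) - x * (1 / x)) / ((ln x - 3 / 2) * (ln x - 3 / 2))) (at x)"
      using x by (auto intro!: derivative_eq_intros)
    moreover have "1 * (ln x - 3 / 2) - x * (1 / x) = ln x - 5 / 2" using x by simp
    ultimately show ?thesis by (simp only: power2_eq_square)
  qed
  obtain z where z: "real m < z" "z < real (Suc m)"
    "?g (real (Suc m)) - ?g (real m) = (real (Suc m) - real m) * ((ln z - 5 / 2) / (ln z - 3 / 2) ^ 2)"
    using MVT2[of "real m" "real (Suc m)" ?g "\<lambda>x. (ln x - 5 / 2) / (ln x - 3 / 2) ^ 2"] der by auto
  have lz: "9 / 2 \<le> ln z" using big z by simp
  have "1 < z" "0 < m" using z(1) Suc by linarith+
  have "1 / ln (real (Suc m)) \<le> 1 / ln z"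
    using lz z \<open>1 < z\<close> \<open>0 < m\<close> by (intro divide_left_mono) (auto intro!: mult_pos_pos)
  also have "\<dots> \<le> (ln z - 5 / 2) / (ln z - 3 / 2) ^ 2"
  proof -
    have "1 / l \<le> x / y" if "y \<le> l * x" "l > 0" "y > 0" for l x y :: real
      using that by (simp add: field_simps)
    moreover have "(ln z - 3 / 2) ^ 2 \<le> ln z * (ln z - 5 / 2)"
      using lz by (simp add: algebra_simps power2_eq_square)
    ultimately show ?thesis using lz by auto
  qed
  finally have "1 / ln (real (Suc m)) \<le> ?g (real (Suc m)) - ?g (real m)" using z(3) by simp
  then show ?case using Suc by simp
qed

text \<open>Summation by parts with weight \<open>1 / ln k\<close> carries a linear majorant of
  \<open>theta\<close> over to the count; its slack \<open>H\<close> enters only through boundary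
  terms.\<close>

lemma prime_count_le:
  assumes "m \<ge> 100"
  shows "prime_count m \<le> (6 / 5 * cheb_const + 2 / 100) * (m / (ln m - 3 / 2)) + 1704"
proof -
  define b where "b = 6 / 5 * cheb_const + 2 / 100"
  define H where "H = (\<lambda>k. b * real k + 2025 / 2 - theta k)"
  \<comment> \<open>the square root error term is absorbed by \<open>9 * sqrt k \<le> k / 50 + 2025 / 2\<close> (AM-GM)\<close>
  have H: "H k \<ge> 0" for k
  proof -
    have "0 \<le> (sqrt k - 225) ^ 2" by simp
    then have "9 * sqrt k \<le> 2 / 100 * k + 2025 / 2" by (simp add: power2_diff)
    then show ?thesis using theta_le[of k] by (simp add: H_def b_def algebra_simps)
  qed
  have b: "0 < b" "b \<le> 122 / 100" using cheb_const_bounds by (auto simp: b_def)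
  have "real (prime_count m) = (\<Sum>p | prime p \<and> p \<le> m. 1 / ln (real p) * ln (real p))"
  proof -
    have "(\<Sum>p | prime p \<and> p \<le> m. 1 / ln (real p) * ln (real p)) = (\<Sum>p | prime p \<and> p \<le> m. 1)"
    proof (intro sum.cong refl)
      fix p assume "p \<in> {p. prime p \<and> p \<le> m}"
      then have "ln (real p) > 0" by (auto dest: prime_gt_1_nat)
      then show "1 / ln (real p) * ln (real p) = 1" by simp
    qed
    then show ?thesis by (simp add: prime_count_def)
  qed
  also have "\<dots> = (\<Sum>k = 1..m. 1 / ln (real k) * (theta k - theta (k - 1)))"
    by (rule sum_primes_eq_sum_theta_diff)
  also have "\<dots> = (\<Sum>k = 2..m. 1 / ln (real k) * (theta k - theta (k - 1)))"
    using assms by (simp add: sum.atLeast_Suc_atMost numeral_2_eq_2)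
  also have "\<dots> = (\<Sum>k = 2..m. b * (1 / ln (real k)) - 1 / ln (real k) * (H k - H (k - 1)))"
    by (intro sum.cong) (auto simp: H_def algebra_simps of_nat_diff)
  also have "\<dots> = b * (\<Sum>k = 2..m. 1 / ln (real k)) - (\<Sum>k = 2..m. 1 / ln (real k) * (H k - H (k - 1)))"
    by (simp add: sum_subtractf sum_distrib_left)
  also have "\<dots> \<le> b * (m / (ln m - 3 / 2) + 150) + 1 / ln 2 * H 1"
  proof -
    have "1 / ln (real m) * H m - 1 / ln (real 2) * H 1 \<le> (\<Sum>k = 2..m. 1 / ln (real k) * (H k - H (k - 1)))"
      using assms H by (intro sum_antimono_diff_ge) (auto intro!: divide_left_mono mult_pos_pos)
    moreover have "0 \<le> 1 / ln (real m) * H m" using assms H by simp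
    moreover have "b * (\<Sum>k = 2..m. 1 / ln (real k)) \<le> b * (m / (ln m - 3 / 2) + 150)"
      using sum_inverse_ln_le[OF assms] b by (intro mult_left_mono) auto
    ultimately show ?thesis by simp
  qed
  also have "1 / ln 2 * H 1 \<le> 3 / 2 * (b + 2025 / 2)"
    using ln2_ge_two_thirds H[of 1] b by (intro mult_mono) (auto simp: H_def field_simps)
  \<comment> \<open>The constant: \<open>150 * b + 3/2 * (b + 2025/2) <= 1704\<close> because
    \<open>b <= 1.22\<close>.\<close>
  finally show ?thesis using b unfolding b_def by (simp add: algebra_simps)
qed

text \<open>\<open>exp 15\<close> is about 3269017, just below 3500000.\<close>

lemma ln_ge_15:
  assumes "x \<ge> (3500000::real)"
  shows "15 \<le> ln x"
proof -
  have "15 \<le> ln ((272/100::real) ^ 15)" using ln_272_gt_1 by (subst ln_realpow) auto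
  also have "\<dots> \<le> ln x" using assms by (intro ln_mono) (simp_all add: power_divide)
  finally show ?thesis .
qed

text \<open>For \<open>L >= 15\<close>, \<open>L / (L - 3/2) <= 10/9\<close>. The gap between 10/9
  and 229/200 absorbs the extra 2/100 and the constant 1704.\<close>

lemma prime_count_ln_le:
  assumes "m \<ge> 3500000"
  shows "prime_count m * ln m \<le> 229 / 200 * (6 / 5 * cheb_const) * m"
proof -
  define L where "L = ln (real m)"
  define B where "B = 6 / 5 * cheb_const"
  have B: "B \<ge> 996 / 1000" using cheb_const_bounds by (simp add: B_def)
  have L: "L \<ge> 15" using ln_ge_15[of m] assms by (simp add: L_def)
  \<comment> \<open>The tangent to \<open>ln\<close> at 3500000 makes \<open>ln m\<close> a tiny
    multiple of \<open>m\<close>, so the constant term can be charged to the linear one.\<close>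
  have "ln (3500000::real) \<le> ln (2 ^ 23)" by (intro ln_mono) auto
  also have "\<dots> = 23 * ln 2" by (subst ln_realpow) auto
  finally have "ln (3500000::real) \<le> 16" using ln2_le_25_over_36 by simp
  moreover have "ln m - ln 3500000 \<le> m / 3500000 - 1"
    using ln_le_minus_one[of "m / 3500000"] assms by (simp add: ln_div)
  ultimately have Lm: "L \<le> 16 / 3500000 * m" using assms by (simp add: L_def)
  have "prime_count m * L \<le> ((B + 2 / 100) * (m / (L - 3 / 2)) + 1704) * L"
    using prime_count_le[of m] assms L unfolding L_def B_def by (intro mult_right_mono) auto
  also have "\<dots> = (B + 2 / 100) * m * (L / (L - 3 / 2)) + 1704 * L"
  proof -
    have "(x * (y / d) + z) * l = x * y * (l / d) + z * l" for x y z d l :: real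
      by (simp add: algebra_simps)
    then show ?thesis by blast
  qed
  also have "\<dots> \<le> (B + 2 / 100) * m * (10 / 9) + 1704 * L"
    using L B by (intro add_mono mult_left_mono) (auto simp: field_simps)
  also have "\<dots> \<le> (B + 2 / 100) * m * (10 / 9) + 1704 * (16 / 3500000 * m)" using Lm by simp
  also have "\<dots> = ((B + 2 / 100) * (10 / 9) + 1704 * 16 / 3500000) * m" by (simp add: field_simps)
  also have "\<dots> \<le> (229 / 200 * B) * m"
  proof (rule mult_right_mono)
    show "(B + 2 / 100) * (10 / 9) + 1704 * 16 / 3500000 \<le> 229 / 200 * B" using B by argo
  qed simp
  finally show ?thesis unfolding L_def B_def .
qed

section \<open>Sums of powers of primes\<close>

text \<open>Summation by parts for increasing weights; \<open>f 0 = 0\<close> removes the lower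
  boundary term.\<close>

lemma sum_mono_diff_le:
  fixes f H :: "nat \<Rightarrow> real"
  assumes "f 0 = 0" "\<And>k. f k \<le> f (Suc k)" "\<And>k. H k \<ge> 0"
  shows "(\<Sum>k = 1..m. f k * (H k - H (k - 1))) \<le> f m * H m"
proof (induction m)
  case 0
  then show ?case using assms by simp
next
  case (Suc m)
  have "f m * H m \<le> f (Suc m) * H m" using assms by (intro mult_right_mono) auto
  then show ?case using Suc by (simp add: algebra_simps)
qed

lemma sum_powr_ge:
  assumes "a > 0"
  shows "real t powr (a + 1) / (a + 1) \<le> (\<Sum>k = 1..t. real k powr a)"
proof (induction t)
  case 0
  then show ?case by simp
next
  case (Suc t)
  let ?g = "\<lambda>x::real. x powr (a + 1) / (a + 1)"
  have cont: "continuous_on {real t..real (Suc t)} ?g"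
    using assms by (intro continuous_on_divide continuous_on_powr' continuous_intros) auto
  have der: "(?g has_real_derivative x powr a) (at x)" if "x > 0" for x
    using that assms by (auto intro!: derivative_eq_intros)
  \<comment> \<open>For \<open>t = 0\<close> the left endpoint is 0, where only continuity has been
    shown; hence the mean value theorem with differentiability inside the interval.\<close>
  obtain z where z: "real t < z" "z < real (Suc t)"
    "?g (real (Suc t)) - ?g (real t) = (real (Suc t) - real t) * z powr a"
  proof -
    have "\<exists>l z. real t < z \<and> z < real (Suc t) \<and> (?g has_real_derivative l) (at z) \<and>
        ?g (real (Suc t)) - ?g (real t) = (real (Suc t) - real t) * l"
    proof (intro MVT cont)
      show "?g differentiable (at x)" if "real t < x" for x
        using der[of x] that of_nat_0_le_iff[of t, where ?'a = real]
        unfolding real_differentiable_def by (meson le_less_trans)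
    qed simp
    then obtain l z where lz: "real t < z" "z < real (Suc t)" "(?g has_real_derivative l) (at z)"
        "?g (real (Suc t)) - ?g (real t) = (real (Suc t) - real t) * l" by blast
    have "z > 0" using lz(1) by linarith
    then have "l = z powr a" using DERIV_unique[OF lz(3) der] by simp
    with lz that show ?thesis by blast
  qed
  have "z powr a \<le> real (Suc t) powr a" using z assms by (intro powr_mono2) auto
  then show ?case using Suc z(3) by simp
qed

text \<open>The extremal argument: \<open>up\<close> limits how early the mass
  \<open>theta m\<close> can accumulate, and an increasing weight is cheapest on early mass, that
  is, with density \<open>B\<close> on \<open>[0, t]\<close>. Summation by parts up to
  \<open>t\<close> loses the boundary term \<open>f t * H t\<close>; the primes in
  \<open>(t, m]\<close>, each of weight at least \<open>f t\<close>, pay for it.\<close>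

lemma sum_powr_ln_primes_ge:
  assumes a: "a > 0" and B: "B \<ge> 0" and "t \<le> m" and t: "B * t + e \<le> theta m"
    and up: "\<And>k. k \<le> m \<Longrightarrow> theta k \<le> B * k + e"
  shows "B * (real t powr (a + 1) / (a + 1)) \<le> (\<Sum>p | prime p \<and> p \<le> m. real p powr a * ln (real p))"
proof -
  define f where "f = (\<lambda>k::nat. real k powr a)"
  \<comment> \<open>The value 0 beyond \<open>m\<close>, where \<open>up\<close> says nothing, makes
    \<open>H\<close> nonnegative at every index.\<close>
  define H where "H = (\<lambda>k. if k \<le> m then B * real k + e - theta k else 0)"
  have f: "f i \<le> f j" if "i \<le> j" for i j using that a by (auto simp: f_def intro!: powr_mono2)
  have "B * (\<Sum>k = 1..t. f k) - f t * H t \<le>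
      B * (\<Sum>k = 1..t. f k) - (\<Sum>k = 1..t. f k * (H k - H (k - 1)))"
  proof -
    have "f 0 = 0" "\<And>k. H k \<ge> 0" using up by (auto simp: f_def H_def)
    then have "(\<Sum>k = 1..t. f k * (H k - H (k - 1))) \<le> f t * H t"
      using f by (intro sum_mono_diff_le) auto
    then show ?thesis by simp
  qed
  also have "\<dots> = (\<Sum>k = 1..t. f k * (theta k - theta (k - 1)))"
    using \<open>t \<le> m\<close> unfolding sum_distrib_left sum_subtractf[symmetric]
    by (intro sum.cong) (auto simp: H_def algebra_simps of_nat_diff)
  finally have lo: "B * (\<Sum>k = 1..t. f k) - f t * H t \<le> (\<Sum>k = 1..t. f k * (theta k - theta (k - 1)))" .
  have tele: "(\<Sum>k = t + 1..m. f t * (theta k - theta (k - 1))) = f t * (theta m - theta t)"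
    using \<open>t \<le> m\<close>
  proof (induction m rule: dec_induct)
    case base
    then show ?case by simp
  next
    case (step n)
    then show ?case by (simp add: algebra_simps)
  qed
  have "B * (real t powr (a + 1) / (a + 1)) \<le> B * (\<Sum>k = 1..t. f k)"
    unfolding f_def using a B by (intro mult_left_mono sum_powr_ge) auto
  also have "\<dots> \<le> B * (\<Sum>k = 1..t. f k) + f t * (theta m - (B * t + e))"
    using t by (simp add: f_def)
  also have "\<dots> = (B * (\<Sum>k = 1..t. f k) - f t * H t) + f t * (theta m - theta t)"
    using \<open>t \<le> m\<close> by (simp add: H_def algebra_simps)
  also have "\<dots> \<le> (\<Sum>k = 1..t. f k * (theta k - theta (k - 1))) +
      (\<Sum>k = t + 1..m. f k * (theta k - theta (k - 1)))"
    using lo f theta_mono unfolding tele[symmetric] by (intro add_mono sum_mono mult_right_mono) auto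
  also have "\<dots> = (\<Sum>k = 1..m. f k * (theta k - theta (k - 1)))"
    using sum.ub_add_nat[of 1 t "\<lambda>k. f k * (theta k - theta (k - 1))" "m - t"] \<open>t \<le> m\<close> by simp
  also have "\<dots> = (\<Sum>p | prime p \<and> p \<le> m. f p * ln (real p))"
    by (rule sum_primes_eq_sum_theta_diff[symmetric])
  finally show ?thesis by (simp add: f_def)
qed

text \<open>For \<open>L = ln P\<close> the right side is \<open>sqrt P\<close>. The factor 4.02 is
  just large enough for \<open>4/15 * L * (L + 10) <= 2/25 * (83/100 * sqrt P)\<close> in
  \<open>S_ln_ge\<close>.\<close>

lemma exp_half_ge_quadratic:
  assumes "L \<ge> (15::real)"
  shows "402 / 100 * (L * (L + 10)) \<le> exp (L / 2)"
proof -
  define h where "h = L - 15"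
  have h: "h \<ge> 0" "L = 15 + h" using assms by (auto simp: h_def)
  \<comment> \<open>Splitting \<open>15/2\<close> into thirty quarters makes the quadratic Taylor
    bound sharp enough: \<open>(41/32) ^ 30\<close> exceeds 1690.\<close>
  have "(1 + 1 / 4 + (1 / 4) ^ 2 / 2 :: real) ^ 30 \<le> exp (1 / 4) ^ 30"
    using exp_lower_Taylor_quadratic[of "1/4::real"] by (intro power_mono) auto
  also have "exp (1 / 4) ^ 30 = exp (15 / 2 :: real)" by (simp add: exp_of_nat_mult[symmetric])
  finally have "1690 \<le> exp (15 / 2 :: real)" by (simp add: power_divide)
  moreover have "1 + h / 2 + (h / 2) ^ 2 / 2 \<le> exp (h / 2)"
    using exp_lower_Taylor_quadratic[of "h / 2"] h by simp
  ultimately have "1690 * (1 + h / 2 + (h / 2) ^ 2 / 2) \<le> exp (15 / 2) * exp (h / 2)"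
    using h by (intro mult_mono) auto
  also have "\<dots> = exp (L / 2)" by (simp add: h exp_add[symmetric] add_divide_distrib)
  finally have "1690 * (1 + h / 2 + (h / 2) ^ 2 / 2) \<le> exp (L / 2)" .
  moreover have "402 / 100 * (L * (L + 10)) \<le> 1690 * (1 + h / 2 + (h / 2) ^ 2 / 2)"
  proof -
    have "402 / 100 * (L * (L + 10)) = 3015 / 2 + 804 / 5 * h + 201 / 50 * (h * h)"
      by (simp add: h(2) algebra_simps)
    also have "\<dots> \<le> 1690 + 845 * h + 845 / 4 * (h * h)"
      using h(1) by (intro add_mono mult_right_mono) auto
    also have "\<dots> = 1690 * (1 + h / 2 + (h / 2) ^ 2 / 2)"
      by (simp add: power2_eq_square algebra_simps)
    finally show ?thesis .
  qed
  ultimately show ?thesis by linarith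
qed

section \<open>The enumeration of the primes\<close>

lemma nth_prime_Suc: "nth_prime (Suc n) = enumerate {p. prime p} n"
  by (simp add: nth_prime_def)

lemma prime_nth_prime: "prime (nth_prime n)"
  using enumerate_in_set[OF primes_infinite] by (simp add: nth_prime_def)

lemma inj_on_nth_prime: "inj_on nth_prime {1..n}"
proof
  fix i j assume "i \<in> {1..n}" "j \<in> {1..n}" "nth_prime i = nth_prime j"
  then have "i - 1 = j - 1" "1 \<le> i" "1 \<le> j"
    using inj_enumerate[OF primes_infinite] by (auto simp: nth_prime_def inj_def)
  then show "i = j" by simp
qed

text \<open>For positive \<open>P\<close>, \<open>p <= P - 1\<close> means \<open>p < P\<close>;
  this form fits the index sets of \<open>theta\<close> and \<open>prime_count\<close>.\<close>

lemma primes_less_nth_prime: "{p. prime p \<and> p \<le> nth_prime (Suc n) - 1} = nth_prime ` {1..n}"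
proof -
  have "p \<le> nth_prime (Suc n) - 1 \<longleftrightarrow> p < nth_prime (Suc n)" for p
    using prime_gt_0_nat[OF prime_nth_prime[of "Suc n"]] by linarith
  moreover have "{p. prime p \<and> p < nth_prime (Suc n)} = nth_prime ` {1..n}"
  proof (intro equalityI subsetI)
    fix p assume p: "p \<in> {p. prime p \<and> p < nth_prime (Suc n)}"
    then have "\<exists>k. enumerate {p. prime p} k = p"
      by (intro enumerate_Ex primes_infinite) simp
    then obtain k where k: "p = enumerate {p. prime p} k" by blast
    then have "k < n" using p primes_infinite by (simp add: nth_prime_Suc)
    then show "p \<in> nth_prime ` {1..n}" using k nth_prime_Suc[of k]
      by (intro image_eqI[of _ _ "Suc k"]) auto
  next
    fix p assume "p \<in> nth_prime ` {1..n}"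
    then obtain j where "1 \<le> j" "j \<le> n" "p = nth_prime j" by auto
    then have "j - 1 < n" "p = nth_prime (Suc (j - 1))" by auto
    then obtain k where k: "k < n" "p = nth_prime (Suc k)" by blast
    then show "p \<in> {p. prime p \<and> p < nth_prime (Suc n)}"
      using k(1) prime_nth_prime[of "Suc k"] primes_infinite unfolding k(2)
      by (simp add: nth_prime_Suc)
  qed
  ultimately show ?thesis by (simp only:)
qed

lemma nth_prime_mono: "m \<le> n \<Longrightarrow> nth_prime m \<le> nth_prime n"
  using primes_infinite by (simp add: nth_prime_def diff_le_mono)

lemma S_eq_sum_primes: "S \<alpha> n = (\<Sum>p | prime p \<and> p \<le> nth_prime (Suc n) - 1. real p powr \<alpha>)"
  unfolding primes_less_nth_prime S_def by (subst sum.reindex[OF inj_on_nth_prime]) simp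

lemma prime_count_nth_prime: "prime_count (nth_prime (Suc n) - 1) = n"
  unfolding prime_count_def primes_less_nth_prime using card_image[OF inj_on_nth_prime] by simp

lemma prime_count_mono: "m \<le> n \<Longrightarrow> prime_count m \<le> prime_count n"
  unfolding prime_count_def by (intro card_mono) auto

text \<open>With \<open>y = 1 + x\<close>, \<open>y powr (s - 1) >= 1 + (s - 1) * ln y\<close> and
  \<open>ln y >= 1 - 1/y\<close>; multiply by \<open>y\<close>.\<close>

lemma Bernoulli_inequality_powr:
  fixes x s :: real
  assumes "x > -1" "s \<ge> 1"
  shows "1 + s * x \<le> (1 + x) powr s"
proof -
  define y where "y = 1 + x"
  have y: "y > 0" using assms by (simp add: y_def)
  have "1 + (s - 1) * (1 - 1 / y) \<le> 1 + (s - 1) * ln y"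
    using ln_ge_one_minus_inverse[OF y] assms by (intro add_left_mono mult_left_mono) auto
  also have "\<dots> \<le> y powr (s - 1)" using exp_ge_add_one_self y by (simp add: powr_def)
  finally have "y * (1 + (s - 1) * (1 - 1 / y)) \<le> y * y powr (s - 1)"
    using y by (intro mult_left_mono) auto
  also have "y * y powr (s - 1) = y powr s" using y by (simp add: powr_mult_base)
  also have "y * (1 + (s - 1) * (1 - 1 / y)) = 1 + s * x"
  proof -
    have "y * (1 + c * d) = y + c * (y * d)" for c d by (simp add: algebra_simps)
    then have "y * (1 + (s - 1) * (1 - 1 / y)) = y + (s - 1) * (y * (1 - 1 / y))" .
    also have "y * (1 - 1 / y) = x" using y by (simp add: y_def right_diff_distrib)
    finally show ?thesis by (simp add: y_def algebra_simps)
  qed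
  finally show ?thesis by (simp add: y_def)
qed

text \<open>Otherwise at least 350000 primes lie below 3500000, and then
  \<open>350000 * 15 = 5250000\<close> would be at most
  \<open>229/200 * 6/5 * 3500000 = 4809000\<close>.\<close>

lemma nth_prime_ge_3500000:
  assumes "n \<ge> 350000"
  shows "3500000 \<le> nth_prime (Suc n)"
proof (rule ccontr)
  assume *: "\<not> ?thesis"
  have "n = prime_count (nth_prime (Suc n) - 1)" by (rule prime_count_nth_prime[symmetric])
  also have "\<dots> \<le> prime_count 3500000" using * by (intro prime_count_mono) linarith
  finally have "350000 * 15 \<le> real (prime_count 3500000) * ln (real 3500000)"
    using assms ln_ge_15[of 3500000] by (intro mult_mono) auto
  also have "\<dots> \<le> 229 / 200 * (6 / 5 * cheb_const) * real 3500000"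
    by (rule prime_count_ln_le) simp
  also have "\<dots> \<le> 229 / 200 * (6 / 5 * 1) * real 3500000"
    using cheb_const_bounds by simp
  finally show False by simp
qed

lemma nth_prime_bounds:
  assumes "n \<ge> 350000"
  defines "P \<equiv> nth_prime (Suc n)"
  shows "real n * ln P \<le> 229 / 200 * (6 / 5 * cheb_const) * P" and "10 * real n \<le> P"
proof -
  have P: "P \<ge> 3500000" unfolding P_def using assms(1) by (rule nth_prime_ge_3500000)
  have "n \<le> prime_count P"
    using prime_count_mono[of "P - 1" P] prime_count_nth_prime[of n] by (simp add: P_def)
  then have "real n * ln P \<le> prime_count P * ln P" using P by (intro mult_right_mono) auto
  also have "\<dots> \<le> 229 / 200 * (6 / 5 * cheb_const) * P" using P by (rule prime_count_ln_le)
  finally show *: "real n * ln P \<le> 229 / 200 * (6 / 5 * cheb_const) * P" .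
  have "real n * 15 \<le> real n * ln P" using ln_ge_15[of P] P by (intro mult_left_mono) auto
  also note *
  also have "229 / 200 * (6 / 5 * cheb_const) * P \<le> 229 / 200 * (6 / 5 * 1) * P"
    using cheb_const_bounds by (intro mult_right_mono mult_left_mono) auto
  finally show "10 * real n \<le> P" by simp
qed

text \<open>Apply the extremal bound with \<open>e = 9 * R\<close>, then
  \<open>ln p <= ln P\<close>. The hypothesis \<open>5 * \<alpha> <= ln n\<close> keeps
  \<open>(\<alpha> + 1) * d <= 2/25\<close>, so by Bernoulli
  \<open>(1 - d) powr (\<alpha> + 1) >= 23/25\<close>.\<close>

lemma S_ln_ge:
  assumes a: "\<alpha> \<ge> 1" and n: "n \<ge> 350000" and aL: "5 * \<alpha> \<le> ln n"
  defines "P \<equiv> nth_prime (Suc n)"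
  shows "23 / 25 * (6 / 5 * cheb_const) * real P powr (\<alpha> + 1) \<le> (\<alpha> + 1) * 1.2 powr (\<alpha> + 1) * (S \<alpha> n * ln P)"
proof -
  define m where "m = P - 1"
  define A where "A = cheb_const"
  define B where "B = 6 / 5 * A"
  define L where "L = ln (real P)"
  define R where "R = sqrt (real P)"
  \<comment> \<open>\<open>t\<close> is the point up to which the maximal logarithmic density \<open>B\<close> uses up all of \<open>theta m\<close>;
    \<open>d\<close> is the relative loss, so that \<open>t \<ge> P * (1 - d) / 1.2\<close>\<close>
  define t where "t = nat \<lfloor>(theta m - 9 * R) / B\<rfloor>"
  define d where "d = (L + 10) / (A * R)"
  have A: "83 / 100 \<le> A" "A \<le> 1" using cheb_const_bounds by (auto simp: A_def)
  have B: "B > 0" using A by (simp add: B_def)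
  have P: "P \<ge> 3500000" unfolding P_def using n by (rule nth_prime_ge_3500000)
  have L: "L \<ge> 15" using ln_ge_15[of P] P by (simp add: L_def)
  have RR: "R * R = P" "R > 0" using P by (simp_all add: R_def)
  have "ln R = L / 2" using P by (simp add: R_def L_def ln_sqrt)
  then have "R = exp (L / 2)" using RR(2) exp_ln by metis
  then have R: "402 / 100 * (L * (L + 10)) \<le> R" using exp_half_ge_quadratic[OF L] by simp
  have mP: "real m = real P - 1" "m \<ge> 30" using P by (auto simp: m_def)
  have "\<alpha> \<le> L / 5"
  proof -
    have "real n \<le> real P" using nth_prime_bounds(2)[OF n] by (simp add: P_def)
    then have "ln n \<le> L" using n by (simp add: L_def)
    then show ?thesis using aL by simp
  qed
  \<comment> \<open>\<open>\<alpha> <= L/5\<close> and \<open>1 <= L/15\<close>.\<close>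
  then have aL15: "\<alpha> + 1 \<le> 4 / 15 * L" using L by simp
  have LR: "25 * L \<le> L * (L + 10)" using L by (simp add: mult.commute mult_left_mono)
  have d: "0 \<le> d" "(\<alpha> + 1) * d \<le> 2 / 25"
  proof -
    show "0 \<le> d" using A L RR by (simp add: d_def)
    have "(\<alpha> + 1) * (L + 10) \<le> 4 / 15 * L * (L + 10)" using aL15 L by (intro mult_right_mono) auto
    also have "\<dots> = 4 / 15 * (L * (L + 10))" by simp
    also have "\<dots> \<le> 2 / 25 * (83 / 100 * R)" using R RR(2) by linarith
    also have "\<dots> \<le> 2 / 25 * (A * R)" using A RR by (intro mult_left_mono mult_right_mono) auto
    finally show "(\<alpha> + 1) * d \<le> 2 / 25" using A RR unfolding d_def by (simp add: field_simps)
  qed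
  have d1: "d < 1"
  proof -
    have "1 * d \<le> (\<alpha> + 1) * d" using a d(1) by (intro mult_right_mono) auto
    then show ?thesis using d(2) by linarith
  qed
  \<comment> \<open>The loss \<open>A * P * d = R * L + 10 * R\<close> is spent as follows:
    \<open>R * L\<close> on \<open>sqrt m * ln m\<close>, \<open>9 * R\<close> on \<open>e\<close>,
    and the last \<open>R\<close> on all smaller terms, among them the \<open>B\<close> that
    rounding in \<open>t\<close> costs.\<close>
  have th: "A * P * (1 - d) + B \<le> theta m - 9 * R"
  proof -
    have "A * P * d = R * (L + 10)" using A RR(2) by (simp add: d_def RR(1)[symmetric] field_simps)
    moreover have "A * m - 3 - 5 * ln m - sqrt m * ln m \<le> theta m"
      using theta_ge[OF mP(2)] by (simp add: A_def)
    moreover have "ln (real m) \<le> L" using mP unfolding L_def by (intro ln_mono) auto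
    moreover have "sqrt m * ln m \<le> R * L"
      using \<open>ln (real m) \<le> L\<close> mP unfolding R_def by (intro mult_mono) auto
    moreover have "A + 3 + 5 * L + B \<le> R" using R LR A L unfolding B_def by linarith
    moreover have "A * m = A * P - A" by (simp add: mP(1) right_diff_distrib)
    moreover have "A * P * (1 - d) = A * P - A * P * d" "R * (L + 10) = R * L + 10 * R"
      by (simp_all add: algebra_simps)
    ultimately show ?thesis by linarith
  qed
  have pos: "0 \<le> A * P * (1 - d)" using A d1 by simp
  have tB: "B * t \<le> theta m - 9 * R" "theta m - 9 * R \<le> B * t + B"
  proof -
    have nn: "(theta m - 9 * R) / B \<ge> 0" using th pos B by simp
    have "real t \<le> (theta m - 9 * R) / B" using nn by (simp add: t_def)
    then show "B * t \<le> theta m - 9 * R" using B by (simp add: field_simps)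
    have "(theta m - 9 * R) / B \<le> real t + 1" using nn unfolding t_def by linarith
    then show "theta m - 9 * R \<le> B * t + B" using B by (simp add: field_simps)
  qed
  have th_le: "theta k \<le> B * k + 9 * R" if "k \<le> m" for k
  proof -
    have "sqrt k \<le> R" using that mP unfolding R_def by simp
    then show ?thesis using theta_le[of k] by (simp add: A_def B_def)
  qed
  have "t \<le> m"
  proof -
    have "B * t \<le> B * m" using tB(1) th_le[of m] by simp
    then show ?thesis using B by simp
  qed
  have tP: "P * (1 - d) / 1.2 \<le> t"
  proof -
    have "A * (P * (1 - d)) \<le> A * (6 / 5 * t)" using th tB(2) by (simp add: B_def algebra_simps)
    then have "P * (1 - d) \<le> 6 / 5 * t" by (rule mult_left_le_imp_le) (use A in simp)
    moreover have "y / 1.2 \<le> z" if "y \<le> 6 / 5 * z" for y z :: real using that by simp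
    ultimately show ?thesis by blast
  qed
  have "23 / 25 * real P powr (\<alpha> + 1) \<le> (1 - d) powr (\<alpha> + 1) * real P powr (\<alpha> + 1)"
    using Bernoulli_inequality_powr[of "-d" "\<alpha> + 1"] d d1 a by (intro mult_right_mono) auto
  also have "\<dots> = 1.2 powr (\<alpha> + 1) * (P * (1 - d) / 1.2) powr (\<alpha> + 1)"
    using d1 by (simp add: powr_mult powr_divide)
  also have "\<dots> \<le> 1.2 powr (\<alpha> + 1) * t powr (\<alpha> + 1)"
    using tP d1 a by (intro mult_left_mono powr_mono2) auto
  finally have tpow: "23 / 25 * real P powr (\<alpha> + 1) \<le> 1.2 powr (\<alpha> + 1) * t powr (\<alpha> + 1)" .
  have "B * (real t powr (\<alpha> + 1) / (\<alpha> + 1)) \<le> (\<Sum>p | prime p \<and> p \<le> m. real p powr \<alpha> * ln (real p))"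
    using a B \<open>t \<le> m\<close> tB(1) th_le by (intro sum_powr_ln_primes_ge[where e = "9 * R"]) auto
  also have "\<dots> \<le> (\<Sum>p | prime p \<and> p \<le> m. real p powr \<alpha> * L)"
  proof (intro sum_mono mult_left_mono)
    fix p assume "p \<in> {p. prime p \<and> p \<le> m}"
    then show "ln (real p) \<le> L" using mP prime_gt_0_nat unfolding L_def by (intro ln_mono) auto
  qed simp
  also have "\<dots> = S \<alpha> n * L"
    unfolding S_eq_sum_primes P_def[symmetric] m_def by (simp add: sum_distrib_right)
  finally have W: "B * real t powr (\<alpha> + 1) \<le> (\<alpha> + 1) * (S \<alpha> n * L)"
    using a by (simp add: field_simps)
  have "23 / 25 * B * real P powr (\<alpha> + 1) \<le> B * (1.2 powr (\<alpha> + 1) * t powr (\<alpha> + 1))"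
    using mult_left_mono[OF tpow, of B] B by simp
  also have "\<dots> = 1.2 powr (\<alpha> + 1) * (B * t powr (\<alpha> + 1))" by simp
  also have "\<dots> \<le> 1.2 powr (\<alpha> + 1) * ((\<alpha> + 1) * (S \<alpha> n * L))"
    using W by (intro mult_left_mono) auto
  finally show ?thesis unfolding B_def A_def L_def by (simp add: mult_ac)
qed

text \<open>The factors \<open>ln P\<close> and \<open>6/5 * cheb_const\<close> of the two bounds
  cancel. What is left is \<open>(229/200) / (23/25) = 229/184\<close>, and
  \<open>229/184 * 1.2\<close> is about 1.493, below 3/2.\<close>

lemma nth_prime_powr_le:
  assumes a: "\<alpha> \<ge> 1" and n: "n \<ge> 350000" and aL: "5 * \<alpha> \<le> ln n"
  defines "P \<equiv> nth_prime (Suc n)"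
  shows "real n * real P powr \<alpha> \<le> 3 / 2 * ((\<alpha> + 1) * 1.2 powr \<alpha>) * S \<alpha> n"
proof -
  define X where "X = (\<alpha> + 1) * 1.2 powr \<alpha>"
  define L where "L = ln (real P)"
  define B where "B = 6 / 5 * cheb_const"
  have P: "P \<ge> 3500000" unfolding P_def using n by (rule nth_prime_ge_3500000)
  have L: "L \<ge> 15" using ln_ge_15[of P] P by (simp add: L_def)
  have Sge: "S \<alpha> n \<ge> 0" unfolding S_def by (intro sum_nonneg) auto
  have p1: "real P powr (\<alpha> + 1) = real P powr \<alpha> * P" using P by (simp add: powr_add)
  have "real n * L * P powr \<alpha> \<le> 229 / 200 * B * P * P powr \<alpha>"
    using nth_prime_bounds(1)[OF n] unfolding L_def B_def P_def by (intro mult_right_mono) auto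
  also have "\<dots> = 229 / 184 * (23 / 25 * B * P powr (\<alpha> + 1))" by (simp add: p1)
  also have "\<dots> \<le> 229 / 184 * ((\<alpha> + 1) * 1.2 powr (\<alpha> + 1) * (S \<alpha> n * L))"
    using S_ln_ge[OF a n aL] unfolding L_def B_def P_def by (intro mult_left_mono) auto
  also have "\<dots> = 229 / 184 * 1.2 * (X * S \<alpha> n * L)" by (simp add: powr_add X_def)
  also have "\<dots> \<le> 3 / 2 * (X * S \<alpha> n * L)" using a Sge L by (intro mult_right_mono) (auto simp: X_def)
  finally have "(real n * P powr \<alpha>) * L \<le> (3 / 2 * X * S \<alpha> n) * L" by (simp add: mult_ac)
  then show ?thesis using L unfolding X_def by simp
qed

text \<open>As \<open>1 + q/(1 + q) = (1 + 2*q)/(1 + q)\<close>, the worst case is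
  \<open>- ln ((1 + q)^2 / (1 + 2*q))\<close>, where
  \<open>(1 + q)^2 = (1 + 2*q) + q^2\<close>.\<close>

lemma ln_one_plus_diff_ge:
  fixes q q' :: real
  assumes "q > 0" "q / (1 + q) \<le> q'"
  shows "- (q\<^sup>2 / (1 + 2 * q)) \<le> ln (1 + q') - ln (1 + q)"
proof -
  have "ln ((1 + q) ^ 2 / (1 + 2 * q)) \<le> (1 + q) ^ 2 / (1 + 2 * q) - 1"
    using assms(1) by (intro ln_le_minus_one) auto
  also have "\<dots> = ((1 + q) ^ 2 - (1 + 2 * q)) / (1 + 2 * q)"
    using assms(1) by (simp add: diff_divide_distrib)
  also have "(1 + q) ^ 2 - (1 + 2 * q) = q\<^sup>2" by (simp add: power2_eq_square algebra_simps)
  also have "ln ((1 + q) ^ 2 / (1 + 2 * q)) = 2 * ln (1 + q) - ln (1 + 2 * q)"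
    using assms(1) by (subst ln_div) (auto simp: ln_realpow)
  finally have "2 * ln (1 + q) - ln (1 + 2 * q) \<le> q\<^sup>2 / (1 + 2 * q)" .
  moreover have "ln (1 + 2 * q) - ln (1 + q) \<le> ln (1 + q')"
  proof -
    have "(1 + 2 * q) / (1 + q) = 1 + q / (1 + q)" using assms(1) by (simp add: field_simps)
    also have "\<dots> \<le> 1 + q'" using assms(2) by (rule add_left_mono)
    finally have "ln ((1 + 2 * q) / (1 + q)) \<le> ln (1 + q')" using assms(1) by (intro ln_mono) auto
    moreover have "ln ((1 + 2 * q) / (1 + q)) = ln (1 + 2 * q) - ln (1 + q)"
      using assms(1) by (subst ln_div) auto
    ultimately show ?thesis by linarith
  qed
  ultimately show ?thesis by linarith
qed

text \<open>Over the common denominator \<open>x * (x + 1) * (x + 2)\<close> the numerator regroups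
  into \<open>l0\<close> and the first and second differences of \<open>l\<close>, which isolates
  the dominant \<open>2 * l0\<close>.\<close>

lemma second_difference_pos:
  fixes x l0 l1 l2 :: real
  assumes "x > 0" "2 * x * (l1 - l0) < 2 * l0 + x * (x + 1) * ((l2 - l1) - (l1 - l0))"
  shows "l1 / (x + 1) - l0 / x < l2 / (x + 2) - l1 / (x + 1)"
proof -
  have "l2 / (x + 2) - l1 / (x + 1) - (l1 / (x + 1) - l0 / x)
      = (2 * l0 + x * (x + 1) * ((l2 - l1) - (l1 - l0)) - 2 * x * (l1 - l0)) / (x * (x + 1) * (x + 2))"
  proof -
    let ?D = "x * (x + 1) * (x + 2)"
    have nz: "x \<noteq> 0" "x + 1 \<noteq> 0" "x + 2 \<noteq> 0" "?D \<noteq> 0" using assms(1) by auto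
    have e: "l0 / x = l0 * ((x + 1) * (x + 2)) / ?D" "l1 / (x + 1) = l1 * (x * (x + 2)) / ?D"
      "l2 / (x + 2) = l2 * (x * (x + 1)) / ?D"
      by (simp_all only: frac_eq_eq[OF nz(1,4)] frac_eq_eq[OF nz(2,4)] frac_eq_eq[OF nz(3,4)])
        (simp_all add: algebra_simps)
    show ?thesis unfolding e diff_divide_distrib[symmetric]
      by (rule arg_cong[where f = "\<lambda>z. z / ?D"]) (simp add: algebra_simps)
  qed
  also have "\<dots> > 0" using assms by (intro divide_pos_pos mult_pos_pos) auto
  finally show ?thesis by simp
qed

section \<open>Monotonicity of the ratios\<close>

lemma ratio_less_Suc:
  assumes a: "\<alpha> \<ge> 1" and n: "n \<ge> N \<alpha>"
  shows "ratio \<alpha> n < ratio \<alpha> (Suc n)"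
proof -
  define X where "X = (\<alpha> + 1) * 1.2 powr \<alpha>"
  define x where "x = real n"
  define p where "p = (\<lambda>k. real (nth_prime k) powr \<alpha>)"
  define l where "l = (\<lambda>k. ln (S \<alpha> k / real k))"
  define q where "q = (\<lambda>k. p (Suc k) / S \<alpha> k)"
  define Q where "Q = x * q n"
  have n0: "n \<ge> 350000" using n by (simp add: N_def)
  have x: "x \<ge> 350000" using n0 by (simp add: x_def)
  have twelve: "1 + 1 / 5 * \<alpha> \<le> 1.2 powr \<alpha>"
    using Bernoulli_inequality_powr[of "1/5" \<alpha>] a by simp
  have X: "X \<ge> 2"
    using mult_mono[of 2 "\<alpha> + 1" 1 "1.2 powr \<alpha>"] twelve a by (simp add: X_def)
  \<comment> \<open>In terms of \<open>X\<close> the exponent in \<open>N \<alpha>\<close> is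
    \<open>(1.2 * X^2 + 1.2 * X) / \<alpha>\<close>.\<close>
  have lnx: "1.2 * X\<^sup>2 + 1.2 * X \<le> \<alpha> * ln x"
  proof -
    define E where "E = (\<alpha> + 1)^2 * 1.2 powr (2*\<alpha> + 1) + (\<alpha> + 1) * 1.2 powr (\<alpha> + 1)"
    have "nat \<lceil>exp (E / \<alpha>)\<rceil> \<le> n" using n unfolding N_def E_def by (rule max.boundedE)
    then have "exp (E / \<alpha>) \<le> x" unfolding x_def by linarith
    then have "E / \<alpha> \<le> ln x" using ln_ge_iff[of x "E / \<alpha>"] x by linarith
    then have "E \<le> \<alpha> * ln x" using a pos_divide_le_eq[of \<alpha> E "ln x"] by (simp add: mult.commute)
    moreover have "(1.2::real) powr (2*\<alpha> + 1) = (1.2 powr \<alpha>)\<^sup>2 * 1.2"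
    proof -
      have "(1.2::real) powr (2*\<alpha> + 1) = 1.2 powr (\<alpha> + \<alpha>) * 1.2 powr 1"
        by (subst powr_add[symmetric]) (simp only: mult_2)
      then show ?thesis by (simp only: powr_add[of _ \<alpha> \<alpha>] power2_eq_square powr_one)
    qed
    moreover have "(1.2::real) powr (\<alpha> + 1) = 1.2 powr \<alpha> * 1.2"
      by (simp only: powr_add powr_one)
    ultimately show ?thesis by (simp only: E_def X_def power_mult_distrib mult_ac)
  qed
  \<comment> \<open>Replacing \<open>X\<close> by its Bernoulli minorant \<open>Y\<close> turns the
    claim into a polynomial inequality in \<open>\<alpha>\<close>.\<close>
  have aL: "5 * \<alpha> \<le> ln x"
  proof -
    define Y where "Y = (\<alpha> + 1) * (1 + 1 / 5 * \<alpha>)"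
    have Y: "Y \<le> X" "Y \<ge> 0" using twelve a unfolding X_def Y_def by (auto intro!: mult_left_mono)
    have "5 * \<alpha>\<^sup>2 \<le> 1.2 * Y\<^sup>2 + 1.2 * Y"
    proof -
      \<comment> \<open>9/4 is close to the minimum of the next quadratic, whose positivity follows
        from this square.\<close>
      have "0 \<le> (\<alpha> - 9 / 4)\<^sup>2" by simp
      then have "0 \<le> 72 / 125 * (\<alpha> * \<alpha>) - 319 / 125 * \<alpha> + 108 / 25"
        using a by (simp add: power2_eq_square algebra_simps)
      then have "0 \<le> \<alpha> * (72 / 125 * (\<alpha> * \<alpha>) - 319 / 125 * \<alpha> + 108 / 25)"
        using a by (intro mult_nonneg_nonneg) auto
      moreover have "0 \<le> \<alpha> * \<alpha> * \<alpha> * \<alpha>" using a by simp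
      ultimately have "0 \<le> 6 / 125 * (\<alpha> * \<alpha> * \<alpha> * \<alpha>) +
          \<alpha> * (72 / 125 * (\<alpha> * \<alpha>) - 319 / 125 * \<alpha> + 108 / 25) + 12 / 5"
        by linarith
      also have "\<dots> = 1.2 * Y\<^sup>2 + 1.2 * Y - 5 * \<alpha>\<^sup>2"
        by (simp add: Y_def power2_eq_square field_simps)
      finally show ?thesis by simp
    qed
    also have "\<dots> \<le> 1.2 * X\<^sup>2 + 1.2 * X" using Y by (intro add_mono mult_left_mono power_mono) auto
    also note lnx
    finally have "\<alpha> * (5 * \<alpha>) \<le> \<alpha> * ln x" by (simp add: power2_eq_square)
    then show ?thesis using a by simp
  qed
  have pmono: "p k \<le> p j" if "k \<le> j" for k j
    using nth_prime_mono[OF that] a by (auto simp: p_def intro!: powr_mono2)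
  have ppos: "p k > 0" for k using prime_gt_0_nat[OF prime_nth_prime[of k]] by (simp add: p_def)
  have Spos: "S \<alpha> k > 0" if "k > 0" for k
    unfolding S_def using ppos that by (intro sum_pos) (auto simp: p_def)
  have qpos: "q n > 0" using ppos Spos n0 by (simp add: q_def)
  have SSuc: "S \<alpha> (Suc k) = S \<alpha> k * (1 + q k)" if "k > 0" for k
    using Spos[OF that] by (simp add: S_def q_def p_def distrib_left)
  have lSuc: "l (Suc k) - l k = ln (1 + q k) - ln (1 + 1 / k)" if "k > 0" for k
  proof -
    have qk: "1 + q k > 0" using Spos[OF that] ppos[of "Suc k"] by (simp add: q_def add_pos_pos)
    have "ln (1 + 1 / real k) = ln (real (Suc k) / real k)" using that by (simp add: field_simps)
    then show ?thesis using Spos[OF that] qk that by (simp add: l_def SSuc ln_div ln_mult_pos)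
  qed
  have Q_le: "Q \<le> 3 / 2 * X"
    using nth_prime_powr_le[OF a n0] aL Spos[of n] n0
    by (simp add: Q_def q_def p_def x_def X_def divide_le_eq)
  have "S \<alpha> n \<le> (\<Sum>k = 1..n. p (Suc n))" unfolding S_def
  proof (intro sum_mono)
    fix k assume "k \<in> {1..n}"
    then show "real (nth_prime k) powr \<alpha> \<le> p (Suc n)" using pmono[of k "Suc n"] by (simp add: p_def)
  qed
  then have Q1: "Q \<ge> 1" using Spos[of n] n0 by (simp add: Q_def q_def x_def)
  \<comment> \<open>\<open>S \<alpha> n / n\<close> equals \<open>p (Suc n) / Q\<close>, and the
    prime is at least \<open>10 * n\<close> while \<open>10 powr \<alpha> >= 2 * Q\<close>. The
    splitting \<open>10 = 25/3 * 1.2\<close> matches the factor \<open>1.2 powr \<alpha>\<close> of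
    \<open>X\<close>, and Bernoulli handles \<open>3 * (\<alpha> + 1)\<close>.\<close>
  have ln_n: "\<alpha> * ln x + 1 / 2 \<le> l n"
  proof -
    have "2 * (3 / 2 * X) \<le> 10 powr \<alpha>"
    proof -
      have "3 * (\<alpha> + 1) \<le> 1 + \<alpha> * (22 / 3)" using a by simp
      also have "\<dots> \<le> (25 / 3) powr \<alpha>" using Bernoulli_inequality_powr[of "22/3" \<alpha>] a by simp
      finally have "3 * (\<alpha> + 1) * 1.2 powr \<alpha> \<le> (25 / 3) powr \<alpha> * 1.2 powr \<alpha>"
        by (intro mult_right_mono) auto
      also have "\<dots> = 10 powr \<alpha>" by (subst powr_mult[symmetric]) auto
      finally show ?thesis unfolding X_def by argo
    qed
    then have "2 * Q * x powr \<alpha> \<le> 10 powr \<alpha> * x powr \<alpha>" using Q_le by (intro mult_right_mono) auto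
    also have "\<dots> = (10 * x) powr \<alpha>" by (subst powr_mult) (use x in auto)
    also have "\<dots> \<le> p (Suc n)" unfolding p_def
      using nth_prime_bounds(2)[OF n0] a x by (intro powr_mono2) (auto simp: x_def)
    also have "p (Suc n) = Q * (S \<alpha> n / x)" using x Spos[of n] n0 by (simp add: Q_def q_def)
    finally have "Q * (2 * x powr \<alpha>) \<le> Q * (S \<alpha> n / x)" by (simp only: mult_ac)
    then have "2 * x powr \<alpha> \<le> S \<alpha> n / x" by (rule mult_left_le_imp_le) (use Q1 in simp)
    then have "ln (2 * x powr \<alpha>) \<le> l n" unfolding l_def x_def[symmetric] using x by (intro ln_mono) auto
    then have "ln 2 + \<alpha> * ln x \<le> l n" using x by (simp add: ln_mult_pos ln_powr)
    then show ?thesis using ln2_ge_two_thirds by linarith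
  qed
  \<comment> \<open>with \<open>Q \<le> 3 / 2 * X\<close> this reduces to \<open>(X - 2)\<^sup>2 \<ge> 0\<close>\<close>
  have QX: "2 * Q + Q\<^sup>2 < 2 * l n"
  proof -
    have "Q\<^sup>2 \<le> (3 / 2 * X)\<^sup>2" using Q_le Q1 by (intro power_mono) auto
    then have "2 * Q + Q\<^sup>2 \<le> 3 * X + 9 / 4 * X\<^sup>2" using Q_le by (simp add: power2_eq_square)
    moreover have "0 \<le> (X - 2)\<^sup>2" by simp
    then have "4 * X \<le> X\<^sup>2 + 4" by (simp add: power2_diff)
    ultimately show ?thesis using lnx ln_n by simp
  qed
  have D0: "l (Suc n) - l n \<le> q n"
  proof -
    have "ln (1 + q n) \<le> q n" using ln_add_one_self_le_self[of "q n"] qpos by simp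
    moreover have "0 \<le> ln (1 + 1 / real n)" by simp
    moreover have "l (Suc n) - l n = ln (1 + q n) - ln (1 + 1 / real n)" using n0 by (intro lSuc) simp
    ultimately show ?thesis by linarith
  qed
  \<comment> \<open>Growing primes give \<open>q (Suc n) >= q n / (1 + q n)\<close>; the decrease of
    \<open>ln (1 + 1/n)\<close> works in the same direction.\<close>
  have D1: "- ((q n)\<^sup>2 / (1 + 2 * q n)) \<le> (l (Suc (Suc n)) - l (Suc n)) - (l (Suc n) - l n)"
  proof -
    have "q n / (1 + q n) = p (Suc n) / S \<alpha> (Suc n)"
      using SSuc[of n] n0 by (simp add: q_def)
    also have "\<dots> \<le> q (Suc n)" unfolding q_def
      using pmono[of "Suc n" "Suc (Suc n)"] Spos[of "Suc n"] by (intro divide_right_mono) auto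
    finally have "- ((q n)\<^sup>2 / (1 + 2 * q n)) \<le> ln (1 + q (Suc n)) - ln (1 + q n)"
      using qpos by (intro ln_one_plus_diff_ge)
    moreover have "ln (1 + 1 / real (Suc n)) \<le> ln (1 + 1 / real n)"
      using n0 by (intro ln_mono add_left_mono divide_left_mono) (auto simp: add_pos_nonneg)
    moreover have "l (Suc n) - l n = ln (1 + q n) - ln (1 + 1 / real n)"
      "l (Suc (Suc n)) - l (Suc n) = ln (1 + q (Suc n)) - ln (1 + 1 / real (Suc n))"
      using n0 by (intro lSuc; simp)+
    ultimately show ?thesis by linarith
  qed
  have "2 * x * (l (Suc n) - l n) \<le> 2 * Q"
    using D0 x unfolding Q_def by simp
  moreover have "- Q\<^sup>2 \<le> x * (x + 1) * ((l (Suc (Suc n)) - l (Suc n)) - (l (Suc n) - l n))"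
  proof -
    have "x * (x + 1) * ((q n)\<^sup>2 / (1 + 2 * q n)) = Q\<^sup>2 * ((x + 1) / (x + 2 * Q))"
    proof -
      have "x + 2 * Q = x * (1 + 2 * q n)" by (simp add: Q_def algebra_simps)
      then show ?thesis using x by (simp add: Q_def power2_eq_square)
    qed
    \<comment> \<open>\<open>Q >= 1\<close> makes \<open>x + 1 <= x + 2 * Q\<close>.\<close>
    also have "\<dots> \<le> Q\<^sup>2 * 1" using x Q1 by (intro mult_left_mono) (auto simp: divide_le_eq)
    finally show ?thesis using mult_left_mono[OF D1, of "x * (x + 1)"] x by simp
  qed
  ultimately have "l (Suc n) / (x + 1) - l n / x < l (Suc (Suc n)) / (x + 2) - l (Suc n) / (x + 1)"
    using QX x by (intro second_difference_pos) auto
  moreover have "ln (ratio \<alpha> k) = l (Suc k) / (real k + 1) - l k / real k" "ratio \<alpha> k > 0" if "k > 0" for k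
    using Spos[of k] Spos[of "Suc k"] that
    by (simp_all add: ratio_def l_def ln_div ln_root add.commute)
  ultimately have "ln (ratio \<alpha> n) < ln (ratio \<alpha> (Suc n))" and "ratio \<alpha> n > 0" "ratio \<alpha> (Suc n) > 0"
    using n0 by (simp_all add: x_def add.commute)
  then show ?thesis by simp
qed

theorem theorem2p6:
  fixes \<alpha> :: real
  assumes "\<alpha> \<ge> 1"
  shows "strict_mono_on {N \<alpha>..} (ratio \<alpha>)"
proof (rule strict_mono_onI)
  fix m n assume "m \<in> {N \<alpha>..}" "n \<in> {N \<alpha>..}" "m < n"
  have "ratio \<alpha> m < ratio \<alpha> (m + Suc k)" for k
  proof (induction k)
    case 0
    then show ?case using ratio_less_Suc[OF assms, of m] \<open>m \<in> {N \<alpha>..}\<close> by simp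
  next
    case (Suc k)
    then show ?case using ratio_less_Suc[OF assms, of "m + Suc k"] \<open>m \<in> {N \<alpha>..}\<close> by simp
  qed
  from this[of "n - Suc m"] show "ratio \<alpha> m < ratio \<alpha> n" using \<open>m < n\<close> by simp
qed

end
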